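(* Let $T$ be the operator $Tf=f\circ\theta$ induced by an irrational rotation $\theta$ of the circle $\mathbb T$. Then there exists a function $f$ such that $f\in(I-T)H^r(\mathbb T)$ for each $0<r<1$, and $\frac1n\sum_{k=0}^{n-1}T^kf$ does not converge a.e.
   Context: $\mathbb T$ is the unit circle with normalized Lebesgue measure; an irrational rotation is $\theta(e^{it})=e^{i(t+2\pi\alpha)}$ with $\alpha$ irrational. For $0<r<1$, $H^r(\mathbb D)$ is the space of holomorphic functions $f$ on the open unit disc $\mathbb D$ with $\sup_{R<1}\frac1{2\pi}\int_0^{2\pi}|f(Re^{it})|^r dt<\infty$; each such $f$ has radial limits $f(e^{it})=\lim_{R\to1^-}f(Re^{it})$ for a.e. $t$, and $H^r(\mathbb T)\subset L^r(\mathbb T)$ denotes the set of all these boundary functions. $(I-T)H^r(\mathbb T)=\{g-Tg:g\in H^r(\mathbb T)\}$. *)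

theory Defs
  imports "HOL-Complex_Analysis.Complex_Analysis" "HOL-Probability.Probability"
begin

definition circle_measure :: "complex measure" where
  "circle_measure =
     distr (uniform_measure lborel {0..<2 * pi}) (restrict_space borel (sphere 0 1)) cis"

lemma space_circle_measure: "space circle_measure = sphere 0 1"
  by (simp add: circle_measure_def space_restrict_space)

lemma prob_space_circle_measure: "prob_space circle_measure"
  unfolding circle_measure_def
proof (rule prob_space.prob_space_distr)
  show "prob_space (uniform_measure lborel {0..<2 * pi :: real})"
    by (rule prob_space_uniform_measure) auto
  have "cis \<in> borel_measurable borel"
    by (intro borel_measurable_continuous_onI continuous_intros)
  then have "cis \<in> borel_measurable (uniform_measure lborel {0..<2 * pi})"
    by (simp cong: measurable_cong_sets)
  then show "cis \<in> uniform_measure lborel {0..<2 * pi} \<rightarrow>\<^sub>M restrict_space borel (sphere 0 1)"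
    by (intro measurable_restrict_space2) auto
qed

definition circle_rotation :: "real \<Rightarrow> complex \<Rightarrow> complex" where
  "circle_rotation \<alpha> z = cis (2 * pi * \<alpha>) * z"

lemma circle_rotation_cis: "circle_rotation \<alpha> (cis t) = cis (t + 2 * pi * \<alpha>)"
  by (simp add: circle_rotation_def cis_mult add.commute)

definition rotation_op :: "real \<Rightarrow> (complex \<Rightarrow> complex) \<Rightarrow> complex \<Rightarrow> complex" where
  "rotation_op \<alpha> f = f \<circ> circle_rotation \<alpha>"

definition hardy_disc :: "real \<Rightarrow> (complex \<Rightarrow> complex) set" where
  "hardy_disc r = {F. F holomorphic_on ball 0 1 \<and>
     bdd_above ((\<lambda>R. 1 / (2 * pi) *
        integral {0..2 * pi} (\<lambda>t. norm (F (of_real R * cis t)) powr r)) ` {0..<1})}"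

(* The elements are functions rather than classes modulo null sets: all measurable
   representatives of a boundary function are included. *)
definition hardy_circle :: "real \<Rightarrow> (complex \<Rightarrow> complex) set" where
  "hardy_circle r = {g \<in> borel_measurable circle_measure. \<exists>F\<in>hardy_disc r.
     AE z in circle_measure. ((\<lambda>R. F (of_real R * z)) \<longlongrightarrow> g z) (at_left 1)}"

(* (I - T) H^r, with equality of functions understood modulo null sets. *)
definition hardy_coboundaries :: "real \<Rightarrow> real \<Rightarrow> (complex \<Rightarrow> complex) set" where
  "hardy_coboundaries \<alpha> r = {f \<in> borel_measurable circle_measure. \<exists>g\<in>hardy_circle r.
     AE z in circle_measure. f z = g z - rotation_op \<alpha> g z}"

definition ergodic_average ::
    "((complex \<Rightarrow> complex) \<Rightarrow> complex \<Rightarrow> complex) \<Rightarrow> (complex \<Rightarrow> complex) \<Rightarrow> nat \<Rightarrow> complex \<Rightarrow> complex" where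
  "ergodic_average T f n z = 1 / of_nat n * (\<Sum>k<n. (T ^^ k) f z)"

end

theory Submission
  imports Defs "HOL-Number_Theory.Cong"
begin

text \<open>
  The function is $f = g - Tg$ with transfer function $g(z) = 1/(1-z)$, for every irrational
  $\<alpha>$. Two facts carry the proof.

  The disc is mapped by $g$ into the right half-plane, and by Kolmogorov's argument this
  already puts $g$ into $H^r$ for all $r < 1$ (\<open>hardy_disc_of_Re_pos\<close>):
  the values of $g^r$ lie in a sector of half-opening $r\pi/2 < \pi/2$, in which the modulus
  is controlled by the real part, and the mean of the real part over a circle is its value
  at the centre.

  The averages of $f$ telescope to $(g(z) - g(\theta^n z))/n$, so the question is whether
  $g(\theta^n z)/n$ converges. For an irrational rotation and every $z$, the inequality
  $n\,|1-\theta^n z| \le 10\pi$ holds for infinitely many $n$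
  (\<open>infinitely_many_inhomogeneous_approximations\<close>), so the limit could not be $0$.
  A nonzero limit would make $g(\theta^n z)$ grow linearly, so that the orbit of $z$ would
  converge to $1$; but then $\theta^{n+1} z$ would converge both to $1$ and to $\theta(1) \ne 1$.
  Hence the averages diverge at every point of the circle.
\<close>

section \<open>Holomorphic functions with positive real part\<close>

lemma holomorphic_circle_mean_value:
  fixes h :: "complex \<Rightarrow> complex" and c :: complex and R :: real
  assumes hol: "h holomorphic_on cball c R" and R: "0 \<le> R"
  shows "((\<lambda>t. h (c + of_real R * cis t)) has_integral of_real (2 * pi) * h c) {0..2 * pi}"
proof (cases "R = 0")
  case True
  have "((\<lambda>t. h c) has_integral (2 * pi - 0) *\<^sub>R h c) {0..2 * pi}"
    by (rule has_integral_const_real[of "h c" 0 "2 * pi", simplified, THEN has_integral_eq_rhs]) simp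
  with True show ?thesis by (simp add: scaleR_conv_of_real)
next
  case False
  with R have R0: "R > 0" by simp
  have "((\<lambda>u. h u / (u - c)) has_contour_integral (2 * of_real pi * \<i> * h c)) (circlepath c R)"
    by (rule Cauchy_integral_circlepath_simple) (use hol R0 in auto)
  then have "((\<lambda>t. h (c + R * cis t) / (R * cis t) * R * \<i> * cis t)
      has_integral 2 * of_real pi * \<i> * h c) {0..2 * pi}"
    unfolding circlepath_def by (subst (asm) has_contour_integral_part_circlepath_iff) auto
  then have "((\<lambda>t. - \<i> * (h (c + R * cis t) / (R * cis t) * R * \<i> * cis t))
      has_integral - \<i> * (2 * of_real pi * \<i> * h c)) {0..2 * pi}"
    by (rule has_integral_mult_right)
  moreover have "- \<i> * (h (c + R * cis t) / (R * cis t) * R * \<i> * cis t) = h (c + R * cis t)" for t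
    using R0 by (simp add: field_simps)
  ultimately show ?thesis by (simp add: mult_ac)
qed

text \<open>
  The argument of $w$ is at most $\pi/2$ in modulus, so that of $w^r$ is at most $r\pi/2$.
\<close>
lemma norm_powr_le_Re_powr:
  fixes w :: complex and r :: real
  assumes w: "Re w > 0" and r: "0 \<le> r" "r \<le> 1"
  shows "cos (r * pi / 2) * norm w powr r \<le> Re (w powr of_real r)"
proof -
  have w0: "w \<noteq> 0" using w by auto
  have "\<bar>Im (Ln w)\<bar> \<le> pi / 2" using Re_Ln_pos_lt_imp[OF w] by simp
  then have "r * \<bar>Im (Ln w)\<bar> \<le> r * (pi / 2)"
    using r by (intro mult_left_mono) auto
  then have le: "\<bar>r * Im (Ln w)\<bar> \<le> r * pi / 2"
    using r by (simp add: abs_mult)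
  have "r * pi \<le> 1 * pi" using r by (intro mult_right_mono) auto
  then have "cos (r * pi / 2) \<le> cos \<bar>r * Im (Ln w)\<bar>"
    by (intro cos_monotone_0_pi_le le) auto
  then have "cos (r * pi / 2) \<le> cos (r * Im (Ln w))" by (simp only: cos_abs_real)
  moreover have "Re (w powr of_real r) = norm w powr r * cos (r * Im (Ln w))"
    using w0 by (simp add: powr_def Re_exp)
  ultimately show ?thesis
    by (metis mult.commute mult_right_mono powr_ge_zero)
qed

text \<open>
  Kolmogorov's argument: integrating the sector inequality over a circle turns its right-hand
  side into the real part of $F(0)^r$, a bound independent of the radius.
\<close>
lemma hardy_disc_of_Re_pos:
  fixes F :: "complex \<Rightarrow> complex" and r :: real
  assumes hol: "F holomorphic_on ball 0 1"
    and pos: "\<And>z. z \<in> ball 0 1 \<Longrightarrow> Re (F z) > 0"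
    and r: "0 < r" "r < 1"
  shows "F \<in> hardy_disc r"
proof -
  define c where "c = cos (r * pi / 2)"
  have "r * pi < 1 * pi" using r by (intro mult_strict_right_mono) auto
  then have c: "c > 0" unfolding c_def using r
    by (intro cos_gt_zero_pi) (auto intro: less_trans[of _ 0])
  have "1 / (2 * pi) * integral {0..2 * pi} (\<lambda>t. norm (F (of_real R * cis t)) powr r)
      \<le> Re (F 0 powr of_real r) / c" if R: "R \<in> {0..<1}" for R
  proof -
    have sub: "cball 0 R \<subseteq> ball (0::complex) 1" using R by auto
    have nonpos: "F z \<notin> \<real>\<^sub>\<le>\<^sub>0" if "z \<in> ball 0 1" for z
      using pos[OF that] by (auto simp: complex_nonpos_Reals_iff)
    have "(\<lambda>z. F z powr of_real r) holomorphic_on cball 0 R"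
      using sub nonpos by (intro holomorphic_intros holomorphic_on_subset[OF hol]) auto
    from holomorphic_circle_mean_value[OF this] R
    have "((\<lambda>t. F (of_real R * cis t) powr of_real r)
        has_integral of_real (2 * pi) * F 0 powr of_real r) {0..2 * pi}" by simp
    from has_integral_Re[OF this]
    have mean: "((\<lambda>t. Re (F (of_real R * cis t) powr of_real r))
        has_integral 2 * pi * Re (F 0 powr of_real r)) {0..2 * pi}" by simp
    have in_ball: "of_real R * cis t \<in> ball 0 1" for t
      using R by (simp add: norm_mult)
    have "continuous_on {0..2 * pi} (\<lambda>t. F (of_real R * cis t))"
      by (rule continuous_on_compose2[OF holomorphic_on_imp_continuous_on[OF hol]])
        (use in_ball in \<open>auto intro!: continuous_intros\<close>)
    then have "continuous_on {0..2 * pi} (\<lambda>t. norm (F (of_real R * cis t)) powr r)"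
    proof (intro continuous_intros ballI)
      show "norm (F (of_real R * cis t)) \<noteq> 0" for t
        using pos[OF in_ball[of t]] by auto
    qed auto
    then have int: "(\<lambda>t. norm (F (of_real R * cis t)) powr r) integrable_on {0..2 * pi}"
      by (rule integrable_continuous_real)
    have "c * integral {0..2 * pi} (\<lambda>t. norm (F (of_real R * cis t)) powr r)
        \<le> 2 * pi * Re (F 0 powr of_real r)"
      by (rule has_integral_le[OF has_integral_mult_right[OF integrable_integral[OF int]] mean])
        (use norm_powr_le_Re_powr[OF pos[OF in_ball]] r in \<open>simp add: c_def\<close>)
    then show ?thesis using c by (simp add: field_simps)
  qed
  then show ?thesis
    unfolding hardy_disc_def using hol by (intro CollectI conjI bdd_aboveI2)
qed

section \<open>Inhomogeneous Diophantine approximation\<close>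

text \<open>
  The bound is uniform in $\<alpha>$ and $\<gamma>$. Choose a fraction $h/k$ with
  $|\<alpha> - h/k| < 1/k^2$ and the integer $m$ nearest to $k\<gamma>$. Since $h$ is invertible
  modulo $k$, some $n$ with $k \le n < 2k$ satisfies $nh \equiv m$ modulo $k$; then $n h/k$
  differs from $m/k$ by an integer, and replacing $h/k$ by $\<alpha>$ and $m/k$ by $\<gamma>$ costs
  at most $2/k + 1/(2k)$. Multiplying by $n < 2k$ gives $5$.
\<close>
lemma infinitely_many_inhomogeneous_approximations:
  fixes \<alpha> \<gamma> :: real and N :: nat
  assumes "\<alpha> \<notin> \<rat>"
  obtains n :: nat and j :: int
    where "n > N" "real n * \<bar>real n * \<alpha> - \<gamma> - of_int j\<bar> \<le> 5"
proof -
  \<comment> \<open>A denominator above $N$ gives $n \ge k > N$.\<close>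
  have "infinite (approx_set \<alpha>)" using assms rational_iff_finite_approx_set by blast
  from infinite_approx_set[OF this, of "int N"] obtain h k
    where hk: "(h, k) \<in> approx_set \<alpha>" "k > int N" by blast
  then have k: "k > 0" "coprime h k" and appr: "\<bar>\<alpha> - of_int h / of_int k\<bar> < 1 / (of_int k)\<^sup>2"
    by (auto simp: approx_set_def)
  define m where "m = round (of_int k * \<gamma>)"
  have m: "\<bar>of_int m - of_int k * \<gamma>\<bar> \<le> 1 / 2"
    unfolding m_def by (rule of_int_round_abs_le)
  obtain x where x: "[h * x = 1] (mod k)" using cong_solve_coprime_int k by blast
  define n where "n = k + (x * m) mod k"
  have n: "k \<le> n" "n < 2 * k" using k by (simp_all add: n_def)
  have "[n = x * m] (mod k)" by (simp add: n_def cong_def)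
  then have "[h * n = h * (x * m)] (mod k)" by (rule cong_scalar_left)
  also have "[h * (x * m) = m] (mod k)"
    using cong_scalar_right[OF x, of m] by (simp add: mult.assoc)
  finally obtain j where j: "m = h * n + k * j" by (auto simp: cong_iff_lin)
  define K L where "K = real_of_int k" and "L = real_of_int n"
  have K: "K > 0" "K \<le> L" "L < 2 * K" using k n unfolding K_def L_def by linarith+
  have m_eq: "of_int m = of_int h * L + K * of_int j"
    using j by (simp add: K_def L_def)
  have split: "L * \<alpha> - \<gamma> - of_int (- j) = L * (\<alpha> - of_int h / K) + (of_int m - K * \<gamma>) / K"
    unfolding m_eq using K by (simp add: field_simps)
  have "\<bar>L * \<alpha> - \<gamma> - of_int (- j)\<bar> \<le> L * \<bar>\<alpha> - of_int h / K\<bar> + \<bar>of_int m - K * \<gamma>\<bar> / K"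
    unfolding split using K by (intro order_trans[OF abs_triangle_ineq]) (simp add: abs_mult)
  also have "\<dots> \<le> 2 * K * (1 / K\<^sup>2) + (1 / 2) / K"
    using K appr m unfolding K_def[symmetric]
    by (intro add_mono mult_mono divide_right_mono) auto
  also have "\<dots> = 5 / (2 * K)" using K by (simp add: field_simps power2_eq_square)
  finally have "L * \<bar>L * \<alpha> - \<gamma> - of_int (- j)\<bar> \<le> 2 * K * (5 / (2 * K))"
    using K by (intro mult_mono) auto
  then have "L * \<bar>L * \<alpha> - \<gamma> - of_int (- j)\<bar> \<le> 5" using K by simp
  moreover have "real (nat n) = L" using n k by (simp add: L_def)
  ultimately show thesis using that[of "nat n" "- j"] n hk(2) by simp
qed

section \<open>Orbits of irrational rotations\<close>

lemma norm_one_minus_cis_le: "norm (1 - cis x) \<le> \<bar>x\<bar>"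
proof -
  have "norm (1 - cis x) = 2 * \<bar>sin (x / 2)\<bar>"
    using dist_exp_i_1[of x] by (simp add: cis_conv_exp norm_minus_commute)
  also have "\<dots> \<le> 2 * \<bar>x / 2\<bar>" by (intro mult_left_mono abs_sin_x_le_abs_x) auto
  finally show ?thesis by simp
qed

lemma orbit_approaches_one:
  fixes \<alpha> :: real and N :: nat
  assumes "\<alpha> \<notin> \<rat>" "norm z = 1"
  obtains n where "n > N" "real n * norm (1 - cis (2 * pi * \<alpha> * real n) * z) \<le> 10 * pi"
proof -
  obtain t where t: "z = cis t"
    using assms(2) by (metis cis_Arg sgn_div_norm norm_zero scaleR_one inverse_1 zero_neq_one)
  obtain n :: nat and j :: int where n: "n > N"
    and le: "real n * \<bar>real n * \<alpha> - (- t / (2 * pi)) - of_int j\<bar> \<le> 5"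
    using infinitely_many_inhomogeneous_approximations[OF assms(1)] by blast
  define y where "y = real n * \<alpha> - (- t / (2 * pi)) - of_int j"
  have "2 * pi * \<alpha> * real n + t = 2 * pi * y + 2 * pi * of_int j"
    by (simp add: y_def field_simps)
  then have "cis (2 * pi * \<alpha> * real n) * z = cis (2 * pi * y)"
    unfolding t cis_mult by (simp add: cis_mult[symmetric])
  then have "norm (1 - cis (2 * pi * \<alpha> * real n) * z) \<le> 2 * pi * \<bar>y\<bar>"
    using norm_one_minus_cis_le[of "2 * pi * y"] by (simp add: abs_mult)
  then have "real n * norm (1 - cis (2 * pi * \<alpha> * real n) * z) \<le> 2 * pi * (real n * \<bar>y\<bar>)"
    by (simp add: mult_left_mono mult.left_commute)
  also have "\<dots> \<le> 2 * pi * 5" using le unfolding y_def by (intro mult_left_mono) auto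
  finally show thesis using n that by simp
qed

lemma cis_irrational_multiple_neq_1:
  fixes \<alpha> :: real and n :: nat
  assumes "\<alpha> \<notin> \<rat>" "n > 0"
  shows "cis (2 * pi * \<alpha> * real n) \<noteq> 1"
proof
  assume "cis (2 * pi * \<alpha> * real n) = 1"
  then have "cos (2 * pi * \<alpha> * real n) = 1" by (simp add: complex_eq_iff)
  then obtain i :: int where "2 * pi * \<alpha> * real n = of_int i * (2 * pi)"
    by (auto simp: cos_one_2pi_int)
  then have "\<alpha> = of_int i / of_nat n" using assms(2) by (simp add: field_simps)
  with assms(1) show False by simp
qed

lemma orbit_eventually_neq_1:
  fixes \<alpha> :: real and z :: complex
  assumes "\<alpha> \<notin> \<rat>"
  obtains M where "\<And>n. n > M \<Longrightarrow> cis (2 * pi * \<alpha> * real n) * z \<noteq> 1"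
proof (cases "\<exists>m. cis (2 * pi * \<alpha> * real m) * z = 1")
  case True
  then obtain m where m: "cis (2 * pi * \<alpha> * real m) * z = 1" by blast
  have "cis (2 * pi * \<alpha> * real n) * z \<noteq> 1" if "n > m" for n
  proof -
    have "real n = real (n - m) + real m" using that by simp
    then have "cis (2 * pi * \<alpha> * real n) = cis (2 * pi * \<alpha> * real (n - m)) * cis (2 * pi * \<alpha> * real m)"
      by (simp only: cis_mult distrib_left)
    then have "cis (2 * pi * \<alpha> * real n) * z =
        cis (2 * pi * \<alpha> * real (n - m)) * (cis (2 * pi * \<alpha> * real m) * z)"
      by (simp only: mult.assoc)
    then show ?thesis
      using m that cis_irrational_multiple_neq_1[OF assms, of "n - m"] by simp
  qed
  then show thesis using that by blast
qed (use that in blast)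

section \<open>Coboundaries with transfer function \<open>1 / (1 - z)\<close>\<close>

definition half_plane_map :: "complex \<Rightarrow> complex" where
  "half_plane_map z = 1 / (1 - z)"

lemma cis_orbit_Suc:
  "cis (2 * pi * \<alpha>) * (cis (2 * pi * \<alpha> * real k) * z) = cis (2 * pi * \<alpha> * real (Suc k)) * z"
proof -
  have "2 * pi * \<alpha> * real (Suc k) = 2 * pi * \<alpha> + 2 * pi * \<alpha> * real k"
    by (simp add: distrib_left)
  then show ?thesis by (simp only: cis_mult[symmetric] mult.assoc)
qed

lemma rotation_op_funpow:
  "(rotation_op \<alpha> ^^ k) f z = f (cis (2 * pi * \<alpha> * real k) * z)"
proof (induction k arbitrary: z)
  case (Suc k)
  have "(rotation_op \<alpha> ^^ Suc k) f z = (rotation_op \<alpha> ^^ k) f (cis (2 * pi * \<alpha>) * z)"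
    by (simp add: rotation_op_def circle_rotation_def)
  also have "\<dots> = f (cis (2 * pi * \<alpha>) * (cis (2 * pi * \<alpha> * real k) * z))"
    by (simp only: Suc mult.left_commute)
  finally show ?case by (simp only: cis_orbit_Suc)
qed simp

lemma ergodic_average_coboundary:
  "ergodic_average (rotation_op \<alpha>) (\<lambda>z. g z - rotation_op \<alpha> g z) n z =
     (g z - g (cis (2 * pi * \<alpha> * real n) * z)) / of_nat n"
proof -
  let ?o = "\<lambda>k. g (cis (2 * pi * \<alpha> * real k) * z)"
  have "(rotation_op \<alpha> ^^ k) (\<lambda>z. g z - rotation_op \<alpha> g z) z = ?o k - ?o (Suc k)" for k
    unfolding rotation_op_funpow
    unfolding rotation_op_def circle_rotation_def comp_def cis_orbit_Suc ..
  then have "ergodic_average (rotation_op \<alpha>) (\<lambda>z. g z - rotation_op \<alpha> g z) n z =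
      1 / of_nat n * (\<Sum>k<n. ?o k - ?o (Suc k))"
    by (simp only: ergodic_average_def)
  also have "(\<Sum>k<n. ?o k - ?o (Suc k)) = ?o 0 - ?o n" by (rule sum_lessThan_telescope')
  finally show ?thesis by simp
qed

text \<open>
  The orbit may hit the pole once, where the value is $1/0 = 0$, so it is examined only beyond
  that time. A limit $0$ contradicts the recurrence of the orbit to the pole at rate $1/n$; any other limit
  forces the whole orbit to converge to the pole, which a nontrivial rotation excludes.
\<close>
lemma half_plane_map_orbit_not_convergent:
  fixes \<alpha> :: real and z :: complex
  assumes \<alpha>: "\<alpha> \<notin> \<rat>" and z: "norm z = 1"
  shows "\<not> convergent (\<lambda>n. half_plane_map (cis (2 * pi * \<alpha> * real n) * z) / of_nat n)"
proof
  define w where "w n = cis (2 * pi * \<alpha> * real n) * z" for n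
  define u where "u n = half_plane_map (w n) / of_nat n" for n
  assume "convergent (\<lambda>n. half_plane_map (cis (2 * pi * \<alpha> * real n) * z) / of_nat n)"
  then obtain L where L: "u \<longlonglongrightarrow> L" unfolding convergent_def u_def w_def by blast
  obtain M where M: "\<And>n. n > M \<Longrightarrow> w n \<noteq> 1"
    using orbit_eventually_neq_1[OF \<alpha>] unfolding w_def by blast
  show False
  proof (cases "L = 0")
    case True
    then have "(\<lambda>n. norm (u n)) \<longlonglongrightarrow> 0" using L tendsto_norm_zero by blast
    then have "eventually (\<lambda>n. norm (u n) < 1 / (10 * pi)) sequentially"
      by (rule order_tendstoD) simp
    then obtain N where N: "\<And>n. n \<ge> N \<Longrightarrow> norm (u n) < 1 / (10 * pi)"
      by (auto simp: eventually_sequentially)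
    obtain n where n: "n > max M N" and le: "real n * norm (1 - w n) \<le> 10 * pi"
      using orbit_approaches_one[OF \<alpha> z] unfolding w_def by blast
    have "0 < real n * norm (1 - w n)" using n M[of n] by auto
    then have "1 / (10 * pi) \<le> 1 / (real n * norm (1 - w n))"
      using le by (intro divide_left_mono) auto
    also have "\<dots> = norm (u n)" by (simp add: u_def half_plane_map_def norm_divide norm_mult)
    finally show False using N[of n] n by simp
  next
    case False
    \<comment> \<open>The numbers $1/u_n = n (1 - w_n)$ converge to $1/L$, so $1 - w_n$ tends to $0$.\<close>
    have "(\<lambda>n. inverse (u n) * inverse (of_nat n)) \<longlonglongrightarrow> inverse L * 0"
      by (intro tendsto_mult tendsto_inverse L False lim_inverse_n)
    moreover have "eventually (\<lambda>n. inverse (u n) * inverse (of_nat n) = 1 - w n) sequentially"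
      using eventually_gt_at_top[of M] by eventually_elim (auto simp: u_def half_plane_map_def)
    ultimately have "(\<lambda>n. 1 - w n) \<longlonglongrightarrow> 0" by (simp add: tendsto_cong)
    then have "(\<lambda>n. 1 - (1 - w n)) \<longlonglongrightarrow> 1 - 0" by (intro tendsto_intros)
    then have lim: "w \<longlonglongrightarrow> 1" by simp
    have "(\<lambda>n. cis (2 * pi * \<alpha>) * w n) \<longlonglongrightarrow> cis (2 * pi * \<alpha>) * 1"
      by (intro tendsto_intros lim)
    moreover have "cis (2 * pi * \<alpha>) * w n = w (Suc n)" for n
      unfolding w_def by (rule cis_orbit_Suc)
    ultimately have "(\<lambda>n. w (Suc n)) \<longlonglongrightarrow> cis (2 * pi * \<alpha>)" by simp
    with LIMSEQ_Suc[OF lim] have "cis (2 * pi * \<alpha>) = 1" by (rule LIMSEQ_unique[symmetric])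
    with cis_irrational_multiple_neq_1[OF \<alpha>, of 1] show False by simp
  qed
qed

lemma coboundary_averages_not_convergent:
  fixes \<alpha> :: real and z :: complex
  assumes "\<alpha> \<notin> \<rat>" "norm z = 1"
  shows "\<not> convergent (\<lambda>n. ergodic_average (rotation_op \<alpha>)
           (\<lambda>z. half_plane_map z - rotation_op \<alpha> half_plane_map z) n z)"
proof
  let ?h = "\<lambda>n. half_plane_map (cis (2 * pi * \<alpha> * real n) * z) / of_nat n"
  assume "convergent (\<lambda>n. ergodic_average (rotation_op \<alpha>)
           (\<lambda>z. half_plane_map z - rotation_op \<alpha> half_plane_map z) n z)"
  then have conv: "convergent (\<lambda>n. half_plane_map z / of_nat n - ?h n)"
    by (simp add: ergodic_average_coboundary diff_divide_distrib)
  have "convergent (\<lambda>n. half_plane_map z / of_nat n)"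
    using lim_const_over_n[of "half_plane_map z"] by (rule convergentI)
  from convergent_diff[OF this conv] have "convergent ?h" by simp
  with half_plane_map_orbit_not_convergent[OF assms] show False by simp
qed

lemma AE_circle_measure_neq_1: "AE z in circle_measure. z \<noteq> 1"
proof -
  let ?U = "uniform_measure lborel {0..<2 * pi :: real}"
  have "cis \<in> borel_measurable borel"
    by (intro borel_measurable_continuous_onI continuous_intros)
  then have "cis \<in> borel_measurable ?U" by (simp cong: measurable_cong_sets)
  then have meas: "cis \<in> ?U \<rightarrow>\<^sub>M restrict_space borel (sphere 0 1)"
    by (intro measurable_restrict_space2) auto
  have "AE t in ?U. cis t \<noteq> 1"
  proof (subst AE_uniform_measure)
    show "AE t in lborel. t \<in> {0..<2 * pi} \<longrightarrow> cis t \<noteq> 1"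
      using AE_lborel_singleton[of "0::real"]
    proof eventually_elim
      case (elim t)
      show ?case
      proof (intro impI notI)
        assume t: "t \<in> {0..<2 * pi}" and "cis t = 1"
        then have "cos t = 1" by (simp add: complex_eq_iff)
        then obtain i :: int where i: "t = of_int i * (2 * pi)" by (auto simp: cos_one_2pi_int)
        have "0 < t" using t elim by simp
        then have "0 < i" unfolding i by (simp add: zero_less_mult_iff)
        moreover have "i < 1" using t unfolding i by simp
        ultimately show False by simp
      qed
    qed
  qed auto
  moreover have "{z \<in> space (restrict_space borel (sphere 0 1)). z \<noteq> (1::complex)} = sphere 0 1 - {1}"
    by (auto simp: space_restrict_space)
  then have "{z \<in> space (restrict_space borel (sphere 0 1)). z \<noteq> (1::complex)}
      \<in> sets (restrict_space borel (sphere 0 1))"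
    by (auto simp: sets_restrict_space_iff)
  ultimately show ?thesis
    unfolding circle_measure_def by (subst AE_distr_iff[OF meas]) auto
qed

lemma borel_measurable_circle_measureI:
  "h \<in> borel_measurable borel \<Longrightarrow> h \<in> borel_measurable circle_measure"
  unfolding circle_measure_def by (simp add: measurable_restrict_space1)

lemma half_plane_map_measurable: "half_plane_map \<in> borel_measurable borel"
  unfolding half_plane_map_def by measurable

lemma half_plane_map_in_hardy_circle:
  assumes "0 < r" "r < 1"
  shows "half_plane_map \<in> hardy_circle r"
proof -
  have ne: "z \<noteq> 1" if "z \<in> ball (0::complex) 1" for z using that by auto
  have "half_plane_map \<in> hardy_disc r"
  proof (rule hardy_disc_of_Re_pos)
    show "half_plane_map holomorphic_on ball 0 1"
      unfolding half_plane_map_def using ne by (intro holomorphic_intros) auto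
    show "Re (half_plane_map z) > 0" if "z \<in> ball 0 1" for z
    proof -
      have "Re z < 1" using that complex_Re_le_cmod[of z] by simp
      moreover have "(cmod (1 - z))\<^sup>2 > 0" using ne[OF that] by simp
      ultimately show ?thesis by (simp add: half_plane_map_def Re_divide cmod_power2)
    qed
  qed (use assms in auto)
  moreover have "AE z in circle_measure.
      ((\<lambda>R. half_plane_map (of_real R * z)) \<longlongrightarrow> half_plane_map z) (at_left 1)"
    using AE_circle_measure_neq_1
  proof eventually_elim
    case (elim z)
    have "((\<lambda>R. 1 / (1 - of_real R * z)) \<longlongrightarrow> 1 / (1 - of_real 1 * z)) (at_left 1)"
      using elim by (intro tendsto_intros) auto
    then show ?case by (simp add: half_plane_map_def)
  qed
  ultimately show ?thesis
    by (auto simp: hardy_circle_def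
        intro!: borel_measurable_circle_measureI half_plane_map_measurable)
qed

theorem proposition3p6:
  fixes \<alpha> :: real
  assumes "\<alpha> \<notin> \<rat>"
  shows "\<exists>f :: complex \<Rightarrow> complex.
           (\<forall>r. 0 < r \<and> r < 1 \<longrightarrow> f \<in> hardy_coboundaries \<alpha> r) \<and>
           (AE z in circle_measure.
              \<not> convergent (\<lambda>n. ergodic_average (rotation_op \<alpha>) f n z))"
proof (intro exI conjI allI impI)
  let ?f = "\<lambda>z. half_plane_map z - rotation_op \<alpha> half_plane_map z"
  have "?f \<in> borel_measurable borel"
    unfolding rotation_op_def circle_rotation_def comp_def half_plane_map_def by measurable
  then show "?f \<in> hardy_coboundaries \<alpha> r" if "0 < r \<and> r < 1" for r
    using half_plane_map_in_hardy_circle[of r] that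
    by (auto simp: hardy_coboundaries_def intro: borel_measurable_circle_measureI)
  show "AE z in circle_measure. \<not> convergent (\<lambda>n. ergodic_average (rotation_op \<alpha>) ?f n z)"
    by (rule AE_I2) (simp add: coboundary_averages_not_convergent[OF assms] space_circle_measure)
qed

end
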